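(* (i) Let $K$ be a field of characteristic $p\neq 2,3$ and let $(A,\times)$ be a weak Leibniz algebra over $K$. Then its polarization $(A,\circ,\bullet)$ is a transposed Poisson algebra. (ii) Conversely, let $K$ be a field of characteristic $p\neq 2$ and let $(A,\circ,\bullet)$ be a transposed Poisson algebra over $K$. Then its depolarization $(A,\times)$ is a weak Leibniz algebra.
   Context: An algebra over a field $K$ is a $K$-vector space with a bilinear product (no associativity, commutativity or unit assumed); a dialgebra is a $K$-vector space with two bilinear products. Characteristic $p=0$ is allowed. An algebra $A$ with product written $ab$ is weak Leibniz if, with $[a,b]=ab-ba$, for all $a,b,c\in A$: $$[a,b]c=2a(bc)-2b(ac),\qquad a[b,c]=2(ab)c-2(ac)b.$$ The polarization of an algebra $(A,\times)$ (characteristic $\neq 2$) is the dialgebra $(A,\circ,\bullet)$ with $a\circ b=\frac12(a\times b-b\times a)$ and $a\bullet b=\frac12(a\times b+b\times a)$. The depolarization of a dialgebra $(A,\circ,\bullet)$ is the algebra $(A,\times)$ with $a\times b=a\circ b+a\bullet b$. A dialgebra $(A,\circ,\bullet)$ is transposed Poisson if $(A,\circ)$ is a Lie algebra, $(A,\bullet)$ is an associative commutative algebra (not necessarily unital), and for all $a,b,c\in A$: $$2\,a\bullet(b\circ c)-(a\bullet b)\circ c-b\circ(a\bullet c)=0.$$ *)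

theory Defs
  imports Complex_Main
begin

text \<open>
  The field is a type of class \<open>field\<close>, and the vector space is a whole type with scalar
  multiplication \<open>scale\<close>. A dialgebra is given by two products that are both
  bilinear with respect to the same \<open>scale\<close>.
\<close>

locale nonassoc_algebra = vector_space scale
  for scale :: "'k::field \<Rightarrow> 'a::ab_group_add \<Rightarrow> 'a" +
  fixes mul :: "'a \<Rightarrow> 'a \<Rightarrow> 'a"
  assumes linear_right: "Vector_Spaces.linear scale scale (\<lambda>b. mul a b)"
    and linear_left: "Vector_Spaces.linear scale scale (\<lambda>a. mul a b)"

definition commutator :: "('a \<Rightarrow> 'a \<Rightarrow> 'a) \<Rightarrow> 'a \<Rightarrow> 'a \<Rightarrow> 'a::ab_group_add"
  where "commutator mul a b = mul a b - mul b a"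

locale weak_leibniz_algebra = nonassoc_algebra scale mul
  for scale :: "'k::field \<Rightarrow> 'a::ab_group_add \<Rightarrow> 'a"
    and mul :: "'a \<Rightarrow> 'a \<Rightarrow> 'a" +
  assumes weak_leibniz_left:
      "mul (commutator mul a b) c
        = scale 2 (mul a (mul b c)) - scale 2 (mul b (mul a c))"
    and weak_leibniz_right:
      "mul a (commutator mul b c)
        = scale 2 (mul (mul a b) c) - scale 2 (mul (mul a c) b)"

locale lie_algebra = nonassoc_algebra scale bracket
  for scale :: "'k::field \<Rightarrow> 'a::ab_group_add \<Rightarrow> 'a"
    and bracket :: "'a \<Rightarrow> 'a \<Rightarrow> 'a" +
  assumes alternating: "bracket a a = 0"
    and jacobi:
      "bracket a (bracket b c) + bracket b (bracket c a) + bracket c (bracket a b) = 0"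

locale assoc_comm_algebra = nonassoc_algebra scale mul
  for scale :: "'k::field \<Rightarrow> 'a::ab_group_add \<Rightarrow> 'a"
    and mul :: "'a \<Rightarrow> 'a \<Rightarrow> 'a" +
  assumes mult_assoc: "mul (mul a b) c = mul a (mul b c)"
    and mult_commute: "mul a b = mul b a"

locale transposed_poisson_algebra =
  circ: lie_algebra scale circ + bullet: assoc_comm_algebra scale bullet
  for scale :: "'k::field \<Rightarrow> 'a::ab_group_add \<Rightarrow> 'a"
    and circ :: "'a \<Rightarrow> 'a \<Rightarrow> 'a"
    and bullet :: "'a \<Rightarrow> 'a \<Rightarrow> 'a" +
  assumes transposed_leibniz:
    "scale 2 (bullet a (circ b c)) - circ (bullet a b) c - circ b (bullet a c) = 0"

definition polarization_circ ::
    "('k::field \<Rightarrow> 'a \<Rightarrow> 'a) \<Rightarrow> ('a \<Rightarrow> 'a \<Rightarrow> 'a) \<Rightarrow> 'a \<Rightarrow> 'a \<Rightarrow> 'a::ab_group_add"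
  where "polarization_circ scale mul a b = scale (1 / 2) (mul a b - mul b a)"

definition polarization_bullet ::
    "('k::field \<Rightarrow> 'a \<Rightarrow> 'a) \<Rightarrow> ('a \<Rightarrow> 'a \<Rightarrow> 'a) \<Rightarrow> 'a \<Rightarrow> 'a \<Rightarrow> 'a::ab_group_add"
  where "polarization_bullet scale mul a b = scale (1 / 2) (mul a b + mul b a)"

definition depolarization ::
    "('a \<Rightarrow> 'a \<Rightarrow> 'a) \<Rightarrow> ('a \<Rightarrow> 'a \<Rightarrow> 'a) \<Rightarrow> 'a \<Rightarrow> 'a \<Rightarrow> 'a::ab_group_add"
  where "depolarization circ bullet a b = circ a b + bullet a b"

end

(* Write ab for the bullet product, o for the circ product, and put
     J = (a o b) o c + (b o c) o a + (c o a) o b,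
     P = c(a o b) + a(b o c) + b(c o a),
     T = a o (bc) - b o (ac),   D = a(bc) - b(ac).
   If o is alternating and the bullet product is commutative, the two weak Leibniz identities of
   the depolarization become  J + 2c(a o b) = P + T + D  and  2c(a o b) - J = P + T - D,  so in
   characteristic other than 2 they say  J = D  and  2c(a o b) = P + T.  Now J and P are invariant
   under cyclic permutations of a, b, c, while the cyclic sums of D and T vanish.  Hence 3J = 0 and
   2P = 3P, which leaves J = D = 0 and 2c(a o b) = T, the transposed Poisson identities.  For the
   converse, the cyclic sum of 2c(a o b) = T gives 2P = 0. *)
theory Submission
  imports Defs "HOL-Computational_Algebra.Primes"
begin

text \<open>\<open>of_nat p\<close> vanishes exactly when the characteristic divides
  \<open>p\<close>. A divisor of a prime is 1 or the prime itself, and no field has characteristic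
  1; characteristic 0 is covered because 0 divides no prime.\<close>

lemma of_nat_prime_neq_0:
  assumes "prime p" "CHAR('k::field) \<noteq> p"
  shows "(of_nat p :: 'k) \<noteq> 0"
  using assms CHAR_not_1[where 'a = 'k] by (auto simp: of_nat_eq_0_iff_char_dvd prime_nat_iff)

section \<open>Small scalar multiples and bilinear products\<close>

context vector_space
begin

lemma scale_two: "scale 2 x = x + x"
  using scale_left_distrib[of 1 1 x] by simp

lemma scale_three: "scale 3 x = x + x + x"
  using scale_left_distrib[of 2 1 x] by (simp add: scale_two)

end

context nonassoc_algebra
begin

lemma mul_add_right: "mul a (b + c) = mul a b + mul a c"
  and mul_scale_right: "mul a (scale r b) = scale r (mul a b)"
  using linear_right[of a] by (simp_all add: Vector_Spaces.linear_iff)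

lemma mul_add_left: "mul (a + b) c = mul a c + mul b c"
  and mul_scale_left: "mul (scale r a) c = scale r (mul a c)"
  using linear_left[of c] by (simp_all add: Vector_Spaces.linear_iff)

lemma mul_minus_right: "mul a (- b) = - mul a b"
  using mul_scale_right[of a "-1" b] by simp

lemma mul_minus_left: "mul (- a) b = - mul a b"
  using mul_scale_left[of "-1" a b] by simp

end

lemma nonassoc_algebraI:
  assumes "vector_space scale"
    and "\<And>a b c. mul a (b + c) = mul a b + mul a c"
    and "\<And>r a b. mul a (scale r b) = scale r (mul a b)"
    and "\<And>a b c. mul (a + b) c = mul a c + mul b c"
    and "\<And>r a b. mul (scale r a) b = scale r (mul a b)"
  shows "nonassoc_algebra scale mul"
  unfolding nonassoc_algebra_def nonassoc_algebra_axioms_def Vector_Spaces.linear_iff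
  using assms by auto

text \<open>Common ground of both directions: in characteristic other than 2, the polarization of
  any algebra is an instance, and so is any transposed Poisson algebra. Both directions thus compare
  the same dialgebra with its depolarization \<open>\<star>\<close>.\<close>

locale polarized_dialgebra =
  circ: nonassoc_algebra scale circ + bullet: nonassoc_algebra scale bullet
  for scale :: "'k::field \<Rightarrow> 'a::ab_group_add \<Rightarrow> 'a"
    and circ :: "'a \<Rightarrow> 'a \<Rightarrow> 'a" (infixl "\<odot>" 70)
    and bullet :: "'a \<Rightarrow> 'a \<Rightarrow> 'a" (infixl "\<bullet>" 70) +
  assumes two_neq_0: "(2::'k) \<noteq> 0"
    and circ_self: "a \<odot> a = 0"
    and bullet_commute: "a \<bullet> b = b \<bullet> a"
begin

text \<open>Left-normed, since \<open>\<odot>\<close> associates to the left; by anticommutativity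
  it is the negative of the right-normed sum in \<open>lie_algebra\<close>.\<close>

definition jacobiator :: "'a \<Rightarrow> 'a \<Rightarrow> 'a \<Rightarrow> 'a"
  where "jacobiator a b c = a \<odot> b \<odot> c + b \<odot> c \<odot> a + c \<odot> a \<odot> b"

definition mixed_jacobiator :: "'a \<Rightarrow> 'a \<Rightarrow> 'a \<Rightarrow> 'a"
  where "mixed_jacobiator a b c = c \<bullet> (a \<odot> b) + a \<bullet> (b \<odot> c) + b \<bullet> (c \<odot> a)"

definition derivator :: "'a \<Rightarrow> 'a \<Rightarrow> 'a \<Rightarrow> 'a"
  where "derivator a b c = a \<odot> (b \<bullet> c) - b \<odot> (a \<bullet> c)"

text \<open>As \<open>\<bullet>\<close> is commutative, this is up to sign the associator of
  \<open>a\<close>, \<open>c\<close>, \<open>b\<close>, so it vanishes identically exactly when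
  \<open>\<bullet>\<close> is associative.\<close>

definition bullet_defect :: "'a \<Rightarrow> 'a \<Rightarrow> 'a \<Rightarrow> 'a"
  where "bullet_defect a b c = a \<bullet> (b \<bullet> c) - b \<bullet> (a \<bullet> c)"

abbreviation times :: "'a \<Rightarrow> 'a \<Rightarrow> 'a" (infixl "\<star>" 70)
  where "a \<star> b \<equiv> depolarization (\<odot>) (\<bullet>) a b"

lemma circ_anticommute: "a \<odot> b = - (b \<odot> a)"
proof -
  have "(a + b) \<odot> (a + b) = a \<odot> b + b \<odot> a"
    \<comment> \<open>The square is expanded before any square is replaced by 0, so that the mixed
      terms survive.\<close>
    by (simp only: circ.mul_add_left circ.mul_add_right) (simp add: circ_self)
  then show ?thesis
    by (simp add: circ_self eq_neg_iff_add_eq_0)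
qed

lemma double_cancel: "(x::'a) + x = y + y \<longleftrightarrow> x = y"
  using circ.scale_cancel_left[of 2 x y] two_neq_0 by (simp add: circ.scale_two)

lemma nonassoc_algebra_depolarization: "nonassoc_algebra scale (\<star>)"
  by (rule nonassoc_algebraI[OF circ.vector_space_axioms])
    (simp_all add: depolarization_def circ.mul_add_left circ.mul_add_right
      bullet.mul_add_left bullet.mul_add_right circ.mul_scale_left circ.mul_scale_right
      bullet.mul_scale_left bullet.mul_scale_right circ.scale_right_distrib algebra_simps)

lemma commutator_depolarization: "commutator (\<star>) a b = scale 2 (a \<odot> b)"
  using circ_anticommute[of b a] bullet_commute[of b a]
  by (simp add: commutator_def depolarization_def circ.scale_two)

section \<open>The weak Leibniz identities in terms of the two products\<close>

lemmas expand_times = depolarization_def circ.mul_add_left circ.mul_add_right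
  bullet.mul_add_left bullet.mul_add_right

text \<open>Once the factor 2 is cancelled, the right side contains two of the three terms of
  \<open>mixed_jacobiator a b c\<close>. Adding the missing \<open>c \<bullet> (a \<odot> b)\<close>
  to both sides completes it and doubles the copy on the left.\<close>

lemma left_identity_iff:
  "commutator (\<star>) a b \<star> c = scale 2 (a \<star> (b \<star> c)) - scale 2 (b \<star> (a \<star> c)) \<longleftrightarrow>
   jacobiator a b c + scale 2 (c \<bullet> (a \<odot> b))
     = mixed_jacobiator a b c + derivator a b c + bullet_defect a b c"
proof -
  have "commutator (\<star>) a b \<star> c = scale 2 ((a \<odot> b) \<star> c)"
    unfolding commutator_depolarization
    by (simp add: depolarization_def circ.mul_scale_left bullet.mul_scale_left
        circ.scale_right_distrib)
  then have "commutator (\<star>) a b \<star> c = scale 2 (a \<star> (b \<star> c)) - scale 2 (b \<star> (a \<star> c))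
      \<longleftrightarrow> (a \<odot> b) \<star> c = a \<star> (b \<star> c) - b \<star> (a \<star> c)"
    using two_neq_0 by (simp flip: circ.scale_right_diff_distrib)
  moreover have "jacobiator a b c + scale 2 (c \<bullet> (a \<odot> b))
       - (mixed_jacobiator a b c + derivator a b c + bullet_defect a b c)
     = (a \<odot> b) \<star> c - (a \<star> (b \<star> c) - b \<star> (a \<star> c))"
    unfolding jacobiator_def mixed_jacobiator_def derivator_def bullet_defect_def expand_times
      circ.scale_two
    using circ_anticommute[of "b \<odot> c" a] circ_anticommute[of "c \<odot> a" b]
      circ_anticommute[of c a] bullet_commute[of "a \<odot> b" c]
    by (simp add: circ.mul_minus_right bullet.mul_minus_right algebra_simps)
  ultimately show ?thesis
    by (metis right_minus_eq)
qed

text \<open>This is the left identity for the opposite product, which replaces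
  \<open>\<odot>\<close> by its negative: terms with an even number of factors
  \<open>\<odot>\<close> (\<open>jacobiator\<close>, \<open>bullet_defect\<close>) stay, the others
  change sign.\<close>

lemma right_identity_iff:
  "c \<star> commutator (\<star>) a b = scale 2 (c \<star> a \<star> b) - scale 2 (c \<star> b \<star> a) \<longleftrightarrow>
   scale 2 (c \<bullet> (a \<odot> b)) - jacobiator a b c
     = mixed_jacobiator a b c + derivator a b c - bullet_defect a b c"
proof -
  have "c \<star> commutator (\<star>) a b = scale 2 (c \<star> (a \<odot> b))"
    unfolding commutator_depolarization
    by (simp add: depolarization_def circ.mul_scale_right bullet.mul_scale_right
        circ.scale_right_distrib)
  then have "c \<star> commutator (\<star>) a b = scale 2 (c \<star> a \<star> b) - scale 2 (c \<star> b \<star> a)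
      \<longleftrightarrow> c \<star> (a \<odot> b) = c \<star> a \<star> b - c \<star> b \<star> a"
    using two_neq_0 by (simp flip: circ.scale_right_diff_distrib)
  moreover have "scale 2 (c \<bullet> (a \<odot> b)) - jacobiator a b c
       - (mixed_jacobiator a b c + derivator a b c - bullet_defect a b c)
     = c \<star> (a \<odot> b) - (c \<star> a \<star> b - c \<star> b \<star> a)"
    unfolding jacobiator_def mixed_jacobiator_def derivator_def bullet_defect_def expand_times
      circ.scale_two
    using circ_anticommute[of c "a \<odot> b"] circ_anticommute[of "c \<bullet> a" b]
      circ_anticommute[of "c \<bullet> b" a] circ_anticommute[of c b]
      bullet_commute[of "c \<odot> a" b] bullet_commute[of "b \<odot> c" a]
      bullet_commute[of c a] bullet_commute[of c b]
      bullet_commute[of "c \<bullet> a" b] bullet_commute[of "c \<bullet> b" a]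
    by (simp add: circ.mul_minus_left bullet.mul_minus_left bullet.mul_minus_right algebra_simps)
  ultimately show ?thesis
    by (metis right_minus_eq)
qed

lemma weak_leibniz_identities_iff:
  "commutator (\<star>) a b \<star> c = scale 2 (a \<star> (b \<star> c)) - scale 2 (b \<star> (a \<star> c)) \<and>
   c \<star> commutator (\<star>) a b = scale 2 (c \<star> a \<star> b) - scale 2 (c \<star> b \<star> a) \<longleftrightarrow>
   jacobiator a b c = bullet_defect a b c \<and>
   scale 2 (c \<bullet> (a \<odot> b)) = mixed_jacobiator a b c + derivator a b c"
proof -
  have "J + Q = R + D \<and> Q - J = R - D \<longleftrightarrow> J = D \<and> Q = R" for J Q R D :: 'a
  proof
    assume *: "J + Q = R + D \<and> Q - J = R - D"
    \<comment> \<open>Adding the two equations removes the even terms \<open>J\<close> and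
      \<open>D\<close>; the remaining factor 2 is cancelled.\<close>
    have "Q + Q = (J + Q) + (Q - J)"
      by simp
    also have "\<dots> = R + R"
      using * by simp
    finally have "Q = R"
      by (simp add: double_cancel)
    with * show "J = D \<and> Q = R"
      by simp
  qed simp
  then show ?thesis
    unfolding left_identity_iff right_identity_iff by blast
qed

section \<open>Behaviour under cyclic permutations\<close>

lemma jacobiator_rotate: "jacobiator b c a = jacobiator a b c"
  by (simp add: jacobiator_def algebra_simps)

lemma mixed_jacobiator_rotate: "mixed_jacobiator b c a = mixed_jacobiator a b c"
  by (simp add: mixed_jacobiator_def algebra_simps)

text \<open>Each of the three products such as \<open>a \<odot> (b \<bullet> c)\<close> occurs once
  with each sign, after reordering inside \<open>\<bullet>\<close>.\<close>

lemma derivator_cyclic_sum: "derivator a b c + derivator b c a + derivator c a b = 0"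
  by (simp add: derivator_def bullet_commute[of b a] bullet_commute[of c a] bullet_commute[of c b])

lemma bullet_defect_cyclic_sum:
  "bullet_defect a b c + bullet_defect b c a + bullet_defect c a b = 0"
  by (simp add: bullet_defect_def bullet_commute[of b a] bullet_commute[of c a]
      bullet_commute[of c b])

section \<open>The two implications\<close>

lemma transposed_poisson_if_weak_leibniz:
  assumes three_neq_0: "(3::'k) \<noteq> 0"
    and "weak_leibniz_algebra scale (\<star>)"
  shows "transposed_poisson_algebra scale (\<odot>) (\<bullet>)"
proof -
  interpret weak_leibniz_algebra scale "(\<star>)" by fact
  have J_eq_D: "jacobiator a b c = bullet_defect a b c"
    and Q_eq: "scale 2 (c \<bullet> (a \<odot> b)) = mixed_jacobiator a b c + derivator a b c" for a b c
    using weak_leibniz_identities_iff[of a b c] weak_leibniz_left weak_leibniz_right by auto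
  have J: "jacobiator a b c = 0" for a b c
  proof -
    \<comment> \<open>The left side uses invariance of \<open>jacobiator\<close>, the next line the
      vanishing cyclic sum of \<open>bullet_defect\<close>; characteristic 3 is excluded to divide
      by 3.\<close>
    have "scale 3 (jacobiator a b c) = jacobiator a b c + jacobiator b c a + jacobiator c a b"
      by (simp add: circ.scale_three jacobiator_rotate)
    also have "\<dots> = 0"
      by (simp only: J_eq_D bullet_defect_cyclic_sum)
    finally show ?thesis
      using three_neq_0 by simp
  qed
  have P: "mixed_jacobiator a b c = 0" for a b c
  proof -
    let ?P = "mixed_jacobiator a b c"
    \<comment> \<open>Summing \<open>Q_eq\<close> over the rotations gives \<open>2P = 3P\<close>,
      so \<open>P = 0\<close> by subtraction, without any division.\<close>
    have "?P + ?P = scale 2 (c \<bullet> (a \<odot> b)) + scale 2 (a \<bullet> (b \<odot> c)) + scale 2 (b \<bullet> (c \<odot> a))"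
      by (simp add: circ.scale_two mixed_jacobiator_def algebra_simps)
    also have "\<dots> = ?P + ?P + ?P + (derivator a b c + derivator b c a + derivator c a b)"
      by (simp add: Q_eq mixed_jacobiator_rotate algebra_simps)
    finally show ?thesis
      by (simp add: derivator_cyclic_sum)
  qed
  show ?thesis
  proof unfold_locales
    fix a b c
    show "a \<odot> a = 0"
      by (rule circ_self)
    show "a \<bullet> b = b \<bullet> a"
      by (rule bullet_commute)
    show "a \<odot> (b \<odot> c) + b \<odot> (c \<odot> a) + c \<odot> (a \<odot> b) = 0"
      using J[of a b c] circ_anticommute[of "a \<odot> b" c] circ_anticommute[of "b \<odot> c" a]
        circ_anticommute[of "c \<odot> a" b]
      by (simp add: jacobiator_def neg_eq_iff_add_eq_0 algebra_simps flip: minus_add_distrib)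
    \<comment> \<open>Both \<open>jacobiator\<close> and, being equal to it,
      \<open>bullet_defect\<close> vanish; commutativity turns the latter into
      associativity.\<close>
    have "c \<bullet> (a \<bullet> b) = a \<bullet> (c \<bullet> b)"
      using J_eq_D[of c a b] by (simp add: J bullet_defect_def)
    then show "a \<bullet> b \<bullet> c = a \<bullet> (b \<bullet> c)"
      by (simp add: bullet_commute[of c])
    show "scale 2 (a \<bullet> (b \<odot> c)) - a \<bullet> b \<odot> c - b \<odot> (a \<bullet> c) = 0"
      \<comment> \<open>Positions follow the first occurrence of the variables in
        \<open>Q_eq\<close>, so this is the instance for
        \<open>a \<bullet> (b \<odot> c)\<close>.\<close>
      using Q_eq[of a b c] circ_anticommute[of "a \<bullet> b" c]
      by (simp add: P derivator_def bullet_commute[of _ a])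
  qed
qed

lemma weak_leibniz_if_transposed_poisson:
  assumes "transposed_poisson_algebra scale (\<odot>) (\<bullet>)"
  shows "weak_leibniz_algebra scale (\<star>)"
proof -
  interpret tp: transposed_poisson_algebra scale "(\<odot>)" "(\<bullet>)" by fact
  have J: "jacobiator a b c = 0" for a b c
    using tp.circ.jacobi[of a b c] circ_anticommute[of "a \<odot> b" c]
      circ_anticommute[of "b \<odot> c" a] circ_anticommute[of "c \<odot> a" b]
    by (simp add: jacobiator_def neg_eq_iff_add_eq_0 algebra_simps flip: minus_add_distrib)
  have D: "bullet_defect a b c = 0" for a b c
    by (simp add: bullet_defect_def bullet_commute[of b a] flip: tp.bullet.mult_assoc)
  have Q_eq: "scale 2 (c \<bullet> (a \<odot> b)) = derivator a b c" for a b c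
    using tp.transposed_leibniz[of c a b] circ_anticommute[of "c \<bullet> a" b]
    by (simp add: derivator_def bullet_commute[of c] algebra_simps)
  have P: "mixed_jacobiator a b c = 0" for a b c
  proof -
    \<comment> \<open>The transposed Leibniz rule, summed over the rotations, has the cyclic sum of
      \<open>derivator\<close> on its right side.\<close>
    have "scale 2 (mixed_jacobiator a b c)
        = derivator a b c + derivator b c a + derivator c a b"
      by (simp add: mixed_jacobiator_def circ.scale_right_distrib Q_eq)
    then show ?thesis
      using two_neq_0 by (simp add: derivator_cyclic_sum)
  qed
  show ?thesis
  proof (intro weak_leibniz_algebra.intro weak_leibniz_algebra_axioms.intro
      nonassoc_algebra_depolarization)
    fix a b c
    show "commutator (\<star>) a b \<star> c = scale 2 (a \<star> (b \<star> c)) - scale 2 (b \<star> (a \<star> c))"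
      using weak_leibniz_identities_iff[of a b c] by (simp add: J D P Q_eq)
    show "a \<star> commutator (\<star>) b c = scale 2 (a \<star> b \<star> c) - scale 2 (a \<star> c \<star> b)"
      \<comment> \<open>The equivalence names the commutator pair first and the outer factor last,
        hence the rotation.\<close>
      using weak_leibniz_identities_iff[of b c a] by (simp add: J D P Q_eq)
  qed
qed

end

section \<open>Polarization of an algebra\<close>

context nonassoc_algebra
begin

lemma polarized_dialgebra_polarization:
  assumes "(2::'k) \<noteq> 0"
  shows "polarized_dialgebra scale (polarization_circ scale mul) (polarization_bullet scale mul)"
proof -
  have "nonassoc_algebra scale (polarization_circ scale mul)"
    by (rule nonassoc_algebraI[OF vector_space_axioms])
      (simp_all add: polarization_circ_def mul_add_left mul_add_right mul_scale_left
        mul_scale_right scale_right_diff_distrib scale_right_distrib scale_left_commute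
        mult.commute algebra_simps)
  moreover have "nonassoc_algebra scale (polarization_bullet scale mul)"
    by (rule nonassoc_algebraI[OF vector_space_axioms])
      (simp_all add: polarization_bullet_def mul_add_left mul_add_right mul_scale_left
        mul_scale_right scale_right_distrib scale_left_commute mult.commute algebra_simps)
  ultimately show ?thesis
    unfolding polarized_dialgebra_def polarized_dialgebra_axioms_def
    using assms by (simp add: polarization_circ_def polarization_bullet_def add.commute)
qed

text \<open>The halves of the reversed product cancel. This carries the weak Leibniz hypothesis from
  \<open>mul\<close> to the depolarization of its polarization.\<close>

lemma depolarization_polarization:
  assumes "(2::'k) \<noteq> 0"
  shows "depolarization (polarization_circ scale mul) (polarization_bullet scale mul) = mul"
proof (intro ext)
  fix a b
  have "depolarization (polarization_circ scale mul) (polarization_bullet scale mul) a b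
      = scale (1 / 2) (scale 2 (mul a b))"
    unfolding depolarization_def polarization_circ_def polarization_bullet_def
    by (simp only: scale_two flip: scale_right_distrib) simp
  then show "depolarization (polarization_circ scale mul) (polarization_bullet scale mul) a b
      = mul a b"
    using assms by simp
qed

end

theorem theorem1p2:
  shows "(CHAR('k::field) \<noteq> 2 \<and> CHAR('k) \<noteq> 3 \<longrightarrow>
      (\<forall>(scale :: 'k \<Rightarrow> 'a::ab_group_add \<Rightarrow> 'a) mul.
        weak_leibniz_algebra scale mul \<longrightarrow>
        transposed_poisson_algebra scale
          (polarization_circ scale mul) (polarization_bullet scale mul)))
    \<and>
    (CHAR('k) \<noteq> 2 \<longrightarrow>
      (\<forall>(scale :: 'k \<Rightarrow> 'a \<Rightarrow> 'a) circ bullet.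
        transposed_poisson_algebra scale circ bullet \<longrightarrow>
        weak_leibniz_algebra scale (depolarization circ bullet)))"
proof (intro conjI impI allI)
  fix scale :: "'k \<Rightarrow> 'a \<Rightarrow> 'a" and mul
  assume char: "CHAR('k) \<noteq> 2 \<and> CHAR('k) \<noteq> 3" and "weak_leibniz_algebra scale mul"
  then interpret weak_leibniz_algebra scale mul
    by simp
  have two: "(2::'k) \<noteq> 0" and three: "(3::'k) \<noteq> 0"
    using char of_nat_prime_neq_0[of 2, where 'k = 'k] of_nat_prime_neq_0[of 3, where 'k = 'k]
    by simp_all
  interpret polarized_dialgebra scale "polarization_circ scale mul" "polarization_bullet scale mul"
    using two by (rule polarized_dialgebra_polarization)
  show "transposed_poisson_algebra scale
      (polarization_circ scale mul) (polarization_bullet scale mul)"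
    using three weak_leibniz_algebra_axioms
    by (intro transposed_poisson_if_weak_leibniz) (simp_all add: depolarization_polarization[OF two])
next
  fix scale :: "'k \<Rightarrow> 'a \<Rightarrow> 'a" and circ bullet
  assume char: "CHAR('k) \<noteq> 2" and tp: "transposed_poisson_algebra scale circ bullet"
  interpret tp: transposed_poisson_algebra scale circ bullet
    by (rule tp)
  interpret polarized_dialgebra scale circ bullet
    using of_nat_prime_neq_0[OF two_is_prime_nat char] tp.circ.alternating tp.bullet.mult_commute
    by unfold_locales simp_all
  show "weak_leibniz_algebra scale (depolarization circ bullet)"
    using tp by (rule weak_leibniz_if_transposed_poisson)
qed

end
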